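(* Let $a$ be a real number. (i) If $0\le a\le\frac12$, then for all $x>0$, $$\frac{(1+a)x}{a+\sqrt{1+x^2}}<\arctan x<\frac{(\pi/2)x}{a+\sqrt{1+x^2}}.$$ (ii) If $\frac12<a<\frac2\pi$, then for all $x>0$, $$\frac{4a\bigl(1-a^2\bigr)x}{a+\sqrt{1+x^2}}<\arctan x<\frac{\max\{\pi/2,\,1+a\}\,x}{a+\sqrt{1+x^2}}.$$ (iii) If $a\ge\frac2\pi$, then the inequality in (i) is reversed, that is, for all $x>0$, $$\frac{(\pi/2)x}{a+\sqrt{1+x^2}}<\arctan x<\frac{(1+a)x}{a+\sqrt{1+x^2}}.$$ Moreover, the constants $1+a$ and $\frac\pi2$ in these inequalities are the best possible: for each fixed $a$ in the respective range, the constants $1+a$ (lower bound) and $\frac\pi2$ (upper bound) in (i), the constant $\max\{\pi/2,1+a\}$ (upper bound) in (ii), and the constants $\frac\pi2$ (lower bound) and $1+a$ (upper bound) in (iii) cannot be replaced by a larger constant in the case of a lower bound, or by a smaller constant in the case of an upper bound, with the corresponding inequality still holding for all $x>0$.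
   Context: No optimality is claimed for the constant $4a(1-a^2)$ in the lower bound of (ii). *)

theory Defs
  imports Complex_Main
begin

end

theory Submission
  imports Defs "HOL-Real_Asymp.Real_Asymp"
begin

text \<open>
  With \<open>t = arctan x\<close> the bounds compare \<open>t\<close> with \<open>K sin t / (1 + a cos t)\<close> on \<open>(0, \<pi>/2)\<close>.
  The derivative of the difference has the sign of \<open>N(c) = (1 + a c)\<^sup>2 - K (a + c)\<close>, a convex
  quadratic in \<open>c = cos t\<close>. For \<open>K = 1 + a\<close> it factors, for \<open>K = 4 a (1 - a\<^sup>2)\<close> it is a perfect
  square, and for the remaining constants convexity of \<open>N\<close> combined with the sign of the
  difference at the end points leaves no room for a sign change. Optimality follows from the limits
  \<open>1 + a\<close> and \<open>\<pi>/2\<close> of \<open>(a + sqrt (1 + x\<^sup>2)) arctan x / x\<close> at \<open>0\<close> and at infinity. The same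
  limits also give \<open>1 + a \<le> \<pi>/2\<close> in case (i) and \<open>\<pi>/2 \<le> 1 + a\<close> in case (iii).
\<close>

section \<open>The difference function and its derivative\<close>

definition gap :: "real \<Rightarrow> real \<Rightarrow> real \<Rightarrow> real" where
  "gap a K t = t - K * sin t / (1 + a * cos t)"

definition gap_num :: "real \<Rightarrow> real \<Rightarrow> real \<Rightarrow> real" where
  "gap_num a K c = (1 + a * c)\<^sup>2 - K * (a + c)"

lemma gap_0 [simp]: "gap a K 0 = 0"
  by (simp add: gap_def)

lemma gap_pi_half [simp]: "gap a K (pi/2) = pi/2 - K"
  by (simp add: gap_def)

lemma gap_has_derivative:
  assumes "1 + a * cos t \<noteq> 0"
  shows "(gap a K has_real_derivative gap_num a K (cos t) / (1 + a * cos t)\<^sup>2) (at t)"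
proof -
  have "cos t * (1 + a * cos t) + a * (sin t)\<^sup>2 = a + cos t"
    by (simp add: sin_squared_eq) (simp add: algebra_simps power2_eq_square)
  then have num: "K * cos t * (1 + a * cos t) + K * sin t * (a * sin t) = K * (a + cos t)"
    by (metis (no_types, opaque_lifting) distrib_left mult.assoc mult.left_commute power2_eq_square)
  have "(gap a K has_real_derivative
      1 - (K * cos t * (1 + a * cos t) + K * sin t * (a * sin t)) / (1 + a * cos t)\<^sup>2) (at t)"
    unfolding gap_def[abs_def] using assms
    by (auto intro!: derivative_eq_intros simp: power2_eq_square)
  also have "1 - (K * cos t * (1 + a * cos t) + K * sin t * (a * sin t)) / (1 + a * cos t)\<^sup>2
      = gap_num a K (cos t) / (1 + a * cos t)\<^sup>2"
    unfolding num gap_num_def using assms by (simp add: diff_divide_distrib)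
  finally show ?thesis .
qed

text \<open>The positive factor \<open>p\<close> absorbs both the interval length and the squared
  denominator of the derivative, so sign arguments only involve \<open>gap_num\<close>.\<close>

lemma gap_mvt:
  assumes "0 \<le> a" "0 \<le> u" "u < v" "v \<le> pi/2"
  obtains t p where "u < t" "t < v" "0 < p" "gap a K v - gap a K u = p * gap_num a K (cos t)"
proof -
  have pos: "0 < 1 + a * cos t" if "u \<le> t" "t \<le> v" for t
    using assms that cos_ge_zero[of t] by (simp add: add_pos_nonneg)
  obtain t where t: "u < t" "t < v"
    "gap a K v - gap a K u = (v - u) * (gap_num a K (cos t) / (1 + a * cos t)\<^sup>2)"
    using MVT2[OF \<open>u < v\<close>, of "gap a K" "\<lambda>t. gap_num a K (cos t) / (1 + a * cos t)\<^sup>2"]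
      gap_has_derivative pos by (metis less_irrefl)
  have "0 < (v - u) / (1 + a * cos t)\<^sup>2"
    using pos[of t] t assms by simp
  with t show ?thesis
    by (intro that[of t "(v - u) / (1 + a * cos t)\<^sup>2"]) auto
qed

lemma cos_strict_antimono_pi_half:
  "\<lbrakk>0 \<le> s; s < t; t \<le> pi/2\<rbrakk> \<Longrightarrow> cos t < cos s"
  by (rule cos_monotone_0_pi) auto

text \<open>Exact interpolation error of a quadratic with leading coefficient
  \<open>a\<^sup>2\<close>: convexity with an explicit defect.\<close>

lemma gap_num_chord:
  assumes "c0 < c1" "c1 < c2"
  shows "(c2 - c0) * gap_num a K c1
    = (c2 - c1) * gap_num a K c0 + (c1 - c0) * gap_num a K c2
      - a\<^sup>2 * (c1 - c0) * (c2 - c1) * (c2 - c0)"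
  unfolding gap_num_def by (simp add: algebra_simps power2_eq_square)

lemma gap_num_neg_between:
  assumes "a \<noteq> 0" "c0 < c1" "c1 < c2" "gap_num a K c0 \<le> 0" "gap_num a K c2 \<le> 0"
  shows "gap_num a K c1 < 0"
proof -
  have "(c2 - c1) * gap_num a K c0 \<le> 0" "(c1 - c0) * gap_num a K c2 \<le> 0"
    using assms by (simp_all add: mult_nonneg_nonpos)
  moreover have "0 < a\<^sup>2 * (c1 - c0) * (c2 - c1) * (c2 - c0)"
    using assms by simp
  ultimately have "(c2 - c0) * gap_num a K c1 < 0"
    using gap_num_chord[OF assms(2,3), of a K] by linarith
  then show ?thesis
    using assms by (simp add: mult_less_0_iff)
qed

section \<open>Sign of the gap for each constant\<close>

text \<open>For \<open>K = 1 + a\<close> the quadratic vanishes at \<open>c = 1\<close>; its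
  cofactor decreases weakly in \<open>c\<close>, so its value at \<open>c = 1\<close>
  decides.\<close>

lemma gap_pos_small:
  assumes "0 \<le> a" "a \<le> 1/2" "0 < t" "t < pi/2"
  shows "0 < gap a (1 + a) t"
proof -
  obtain s p where s: "0 < s" "s < t" "0 < p" "gap a (1 + a) t - gap a (1 + a) 0
      = p * gap_num a (1 + a) (cos s)"
    using gap_mvt[of a 0 t] assms by auto
  have c: "cos s < 1" using cos_strict_antimono_pi_half[of 0 s] s assms by simp
  have "a\<^sup>2 * cos s \<le> a\<^sup>2 * 1" using c by (intro mult_left_mono) auto
  moreover have "a\<^sup>2 * cos s < a\<^sup>2" if "a \<noteq> 0" using c that by simp
  \<comment> \<open>This product is the cofactor at \<open>c = 1\<close>. It is zero for
    \<open>a = 1/2\<close>, where strictness comes from \<open>cos s < 1\<close>.\<close>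
  moreover have "0 \<le> (1 - 2 * a) * (1 + a)" using assms by simp
  ultimately have "0 < 1 - a - a\<^sup>2 - a\<^sup>2 * cos s"
    by (cases "a = 0") (auto simp: algebra_simps power2_eq_square)
  moreover have "gap_num a (1 + a) (cos s) = (1 - cos s) * (1 - a - a\<^sup>2 - a\<^sup>2 * cos s)"
    unfolding gap_num_def by (simp add: algebra_simps power2_eq_square)
  ultimately show ?thesis using s c by simp
qed

text \<open>The constant makes the discriminant of \<open>gap_num\<close> vanish, so the gap is
  nondecreasing.\<close>

lemma gap_pos_square:
  assumes "0 < a" "0 < t" "t < pi/2"
  shows "0 < gap a (4 * a * (1 - a\<^sup>2)) t"
proof -
  define K where "K = 4 * a * (1 - a\<^sup>2)"
  have num: "gap_num a K c = (a * c - (1 - 2 * a\<^sup>2))\<^sup>2" for c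
    unfolding gap_num_def K_def by (simp add: algebra_simps power2_eq_square)
  \<comment> \<open>A single mean value point could hit the double root; splitting at
    \<open>t/2\<close> yields two points with different cosines.\<close>
  obtain s p where s: "0 < s" "s < t/2" "0 < p"
      "gap a K (t/2) - gap a K 0 = p * gap_num a K (cos s)"
    using gap_mvt[of a 0 "t/2"] assms by auto
  obtain s' p' where s': "t/2 < s'" "s' < t" "0 < p'"
      "gap a K t - gap a K (t/2) = p' * gap_num a K (cos s')"
    using gap_mvt[of a "t/2" t] assms by auto
  have "cos s' < cos s"
    using s s' assms by (intro cos_strict_antimono_pi_half) auto
  \<comment> \<open>the square vanishes for at most one value of the cosine\<close>
  then have "a * cos s' \<noteq> a * cos s" using assms by simp
  then have "0 < gap_num a K (cos s) \<or> 0 < gap_num a K (cos s')"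
    unfolding num zero_less_power2 by linarith
  moreover have "0 \<le> gap_num a K (cos s)" "0 \<le> gap_num a K (cos s')"
    unfolding num by auto
  ultimately have "0 < p * gap_num a K (cos s) + p' * gap_num a K (cos s')"
    using s s' by (auto intro: add_pos_nonneg add_nonneg_pos)
  then show ?thesis using s s' by (simp add: K_def)
qed

text \<open>The gap is 0 at \<open>0\<close> and \<open>pi/2 - K \<le> 0\<close> at
  \<open>pi/2\<close>. A nonnegative value in between would make \<open>gap_num\<close> nonnegative
  at \<open>cos s\<close>, which lies between \<open>cos s'\<close> and \<open>1\<close>, where it
  is nonpositive.\<close>

lemma gap_neg:
  assumes "0 \<le> a" "pi/2 \<le> K" "1 + a \<le> K" "0 < t" "t < pi/2"
  shows "gap a K t < 0"
proof (rule ccontr)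
  assume "\<not> gap a K t < 0"
  then have t: "0 \<le> gap a K t" by simp
  obtain s p where s: "0 < s" "s < t" "0 < p" "gap a K t - gap a K 0 = p * gap_num a K (cos s)"
    using gap_mvt[of a 0 t] assms by auto
  obtain s' p' where s': "t < s'" "s' < pi/2" "0 < p'"
      "gap a K (pi/2) - gap a K t = p' * gap_num a K (cos s')"
    using gap_mvt[of a t "pi/2"] assms by auto
  have "0 \<le> p * gap_num a K (cos s)" using s t by simp
  then have N: "0 \<le> gap_num a K (cos s)" using s by (simp add: zero_le_mult_iff)
  have "p' * gap_num a K (cos s') \<le> 0" using s' t assms by simp
  then have N': "gap_num a K (cos s') \<le> 0" using s' by (simp add: mult_le_0_iff)
  have c: "cos s' < cos s" using s s' assms by (intro cos_strict_antimono_pi_half) auto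
  have c1: "cos s < 1" using cos_strict_antimono_pi_half[of 0 s] s assms by simp
  show False
  proof (cases "a = 0")
    case True
    \<comment> \<open>Strict convexity is lost, but \<open>gap_num\<close> is now
      \<open>1 - K * c\<close>, strictly decreasing.\<close>
    have "K * cos s' < K * cos s" using c assms pi_gt_zero by simp
    then show False using N N' True by (simp add: gap_num_def)
  next
    case False
    have "gap_num a K 1 = (1 + a) * (1 + a - K)"
      unfolding gap_num_def by (simp add: algebra_simps power2_eq_square)
    then have "gap_num a K 1 \<le> 0"
      using assms by (simp add: mult_nonneg_nonpos)
    then show False using gap_num_neg_between[OF False c c1 N'] N by simp
  qed
qed

text \<open>Mirror image of \<open>gap_neg\<close>: the gap vanishes at both ends, and the outer
  point is \<open>c = 0\<close>, where \<open>gap_num\<close> is \<open>1 - a * pi/2\<close>; the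
  hypothesis on \<open>a\<close> says that this is nonpositive.\<close>

lemma gap_pos_large:
  assumes "2/pi \<le> a" "0 < t" "t < pi/2"
  shows "0 < gap a (pi/2) t"
proof (rule ccontr)
  assume "\<not> 0 < gap a (pi/2) t"
  then have t: "gap a (pi/2) t \<le> 0" by simp
  have a: "0 < a" using assms pi_gt_zero by (smt (verit) divide_pos_pos)
  obtain s p where s: "0 < s" "s < t" "0 < p"
      "gap a (pi/2) t - gap a (pi/2) 0 = p * gap_num a (pi/2) (cos s)"
    using gap_mvt[of a 0 t] assms a by auto
  obtain s' p' where s': "t < s'" "s' < pi/2" "0 < p'"
      "gap a (pi/2) (pi/2) - gap a (pi/2) t = p' * gap_num a (pi/2) (cos s')"
    using gap_mvt[of a t "pi/2", where K = "pi/2"] assms a by auto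
  have "p * gap_num a (pi/2) (cos s) \<le> 0" using s t by simp
  then have N: "gap_num a (pi/2) (cos s) \<le> 0" using s by (simp add: mult_le_0_iff)
  have "0 \<le> p' * gap_num a (pi/2) (cos s')" using s' t by simp
  then have N': "0 \<le> gap_num a (pi/2) (cos s')" using s' by (simp add: zero_le_mult_iff)
  have c: "cos s' < cos s" using s s' assms by (intro cos_strict_antimono_pi_half) auto
  have c0: "0 < cos s'" using s' assms by (intro cos_gt_zero) auto
  have "gap_num a (pi/2) 0 \<le> 0"
    using assms by (simp add: gap_num_def field_simps)
  then show False
    using gap_num_neg_between[OF _ c0 c, of a "pi/2"] N N' a by simp
qed

section \<open>Return to the arctangent, and optimality of the constants\<close>

text \<open>With \<open>t = arctan x\<close>, \<open>sin t\<close> is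
  \<open>x / sqrt (1 + x\<^sup>2)\<close> and \<open>cos t\<close> is
  \<open>1 / sqrt (1 + x\<^sup>2)\<close>. If \<open>a + sqrt (1 + x\<^sup>2)\<close> is zero, both
  quotients are 0 by convention.\<close>

lemma arctan_minus_bound_eq_gap:
  "arctan x - K * x / (a + sqrt (1 + x\<^sup>2)) = gap a K (arctan x)"
proof -
  define s where "s = sqrt (1 + x\<^sup>2)"
  have "0 < s" unfolding s_def by (simp add: add_pos_nonneg)
  then have "1 + a * (1 / s) = (a + s) / s"
    by (simp add: add_divide_distrib)
  then have "K * (x / s) / (1 + a * (1 / s)) = K * x / (a + s)"
    using \<open>0 < s\<close> by simp
  then show ?thesis
    by (simp only: gap_def sin_arctan cos_arctan s_def)
qed

lemma bound_less_arctan_iff: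
  "K * x / (a + sqrt (1 + x\<^sup>2)) < arctan x \<longleftrightarrow> 0 < gap a K (arctan x)"
  using arctan_minus_bound_eq_gap[of x K a] by linarith

lemma arctan_less_bound_iff:
  "arctan x < K * x / (a + sqrt (1 + x\<^sup>2)) \<longleftrightarrow> gap a K (arctan x) < 0"
  using arctan_minus_bound_eq_gap[of x K a] by linarith

lemma arctan_quotient_tendsto_0:
  "((\<lambda>x. (a + sqrt (1 + x\<^sup>2)) * arctan x / x) \<longlongrightarrow> 1 + a) (at_right (0::real))"
  by real_asymp

lemma arctan_quotient_tendsto_at_top:
  "((\<lambda>x. (a + sqrt (1 + x\<^sup>2)) * arctan x / x) \<longlongrightarrow> pi/2) at_top"
  by real_asymp

text \<open>An admissible \<open>c\<close> lies below the quotient at every positive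
  \<open>x\<close>, hence below its limits at both ends.\<close>

lemma lower_constant_le:
  fixes a c :: real
  assumes "0 \<le> a" "\<forall>x>0. c * x / (a + sqrt (1 + x\<^sup>2)) < arctan x"
  shows "c \<le> 1 + a" "c \<le> pi/2"
proof -
  have *: "c \<le> (a + sqrt (1 + x\<^sup>2)) * arctan x / x" if "0 < x" for x
  proof -
    have "0 < a + sqrt (1 + x\<^sup>2)" using assms by (simp add: add_nonneg_pos add_pos_nonneg)
    then show ?thesis using assms(2) that by (auto simp: field_simps intro: less_imp_le)
  qed
  show "c \<le> 1 + a"
    by (rule tendsto_lowerbound[OF arctan_quotient_tendsto_0])
      (auto intro!: * eventually_at_right_less[THEN eventually_mono])
  show "c \<le> pi/2"
    by (rule tendsto_lowerbound[OF arctan_quotient_tendsto_at_top])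
      (auto intro!: * eventually_gt_at_top[of 0, THEN eventually_mono])
qed

lemma upper_constant_ge:
  fixes a c :: real
  assumes "0 \<le> a" "\<forall>x>0. arctan x < c * x / (a + sqrt (1 + x\<^sup>2))"
  shows "1 + a \<le> c" "pi/2 \<le> c"
proof -
  have *: "(a + sqrt (1 + x\<^sup>2)) * arctan x / x \<le> c" if "0 < x" for x
  proof -
    have "0 < a + sqrt (1 + x\<^sup>2)" using assms by (simp add: add_nonneg_pos add_pos_nonneg)
    then show ?thesis using assms(2) that by (auto simp: field_simps intro: less_imp_le)
  qed
  show "1 + a \<le> c"
    by (rule tendsto_upperbound[OF arctan_quotient_tendsto_0])
      (auto intro!: * eventually_at_right_less[THEN eventually_mono])
  show "pi/2 \<le> c"
    by (rule tendsto_upperbound[OF arctan_quotient_tendsto_at_top])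
      (auto intro!: * eventually_gt_at_top[of 0, THEN eventually_mono])
qed

theorem theorem2:
  fixes a :: real
  shows
    "(0 \<le> a \<and> a \<le> 1/2 \<longrightarrow>
        (\<forall>x>0. (1 + a) * x / (a + sqrt (1 + x\<^sup>2)) < arctan x
             \<and> arctan x < (pi/2) * x / (a + sqrt (1 + x\<^sup>2)))
      \<and> (\<forall>c > 1 + a. \<not> (\<forall>x>0. c * x / (a + sqrt (1 + x\<^sup>2)) < arctan x))
      \<and> (\<forall>c < pi/2. \<not> (\<forall>x>0. arctan x < c * x / (a + sqrt (1 + x\<^sup>2)))))
   \<and> (1/2 < a \<and> a < 2/pi \<longrightarrow>
        (\<forall>x>0. 4 * a * (1 - a\<^sup>2) * x / (a + sqrt (1 + x\<^sup>2)) < arctan x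
             \<and> arctan x < max (pi/2) (1 + a) * x / (a + sqrt (1 + x\<^sup>2)))
      \<and> (\<forall>c < max (pi/2) (1 + a). \<not> (\<forall>x>0. arctan x < c * x / (a + sqrt (1 + x\<^sup>2)))))
   \<and> (2/pi \<le> a \<longrightarrow>
        (\<forall>x>0. (pi/2) * x / (a + sqrt (1 + x\<^sup>2)) < arctan x
             \<and> arctan x < (1 + a) * x / (a + sqrt (1 + x\<^sup>2)))
      \<and> (\<forall>c > pi/2. \<not> (\<forall>x>0. c * x / (a + sqrt (1 + x\<^sup>2)) < arctan x))
      \<and> (\<forall>c < 1 + a. \<not> (\<forall>x>0. arctan x < c * x / (a + sqrt (1 + x\<^sup>2)))))"
proof -
  have range: "0 < arctan x" "arctan x < pi/2" if "0 < x" for x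
    using that arctan_ubound by auto
  have small: "\<forall>x>0. (1 + a) * x / (a + sqrt (1 + x\<^sup>2)) < arctan x" if "0 \<le> a" "a \<le> 1/2"
    using that range gap_pos_small by (simp add: bound_less_arctan_iff)
  have square: "\<forall>x>0. 4 * a * (1 - a\<^sup>2) * x / (a + sqrt (1 + x\<^sup>2)) < arctan x" if "0 < a"
    using that range gap_pos_square by (simp add: bound_less_arctan_iff)
  have large: "\<forall>x>0. (pi/2) * x / (a + sqrt (1 + x\<^sup>2)) < arctan x" if "2/pi \<le> a"
    using that range gap_pos_large by (simp only: bound_less_arctan_iff) blast
  have upper: "\<forall>x>0. arctan x < K * x / (a + sqrt (1 + x\<^sup>2))"
    if "0 \<le> a" "pi/2 \<le> K" "1 + a \<le> K" for K
    using that range gap_neg by (simp only: arctan_less_bound_iff) blast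
  note lower_opt = lower_constant_le[of a]
  note upper_opt = upper_constant_ge[of a]
  have large_pos: "0 \<le> a" if "2/pi \<le> a"
    using that pi_gt_zero by (smt (verit) divide_pos_pos)
  \<comment> \<open>No numerical estimate of \<open>pi\<close> is needed: the lower bound
    \<open>small\<close> is compared with the limit at infinity, and below \<open>large\<close> with
    the limit at 0.\<close>
  have small_le: "1 + a \<le> pi/2" if "0 \<le> a" "a \<le> 1/2"
    using lower_opt(2)[OF _ small] that by simp
  have large_ge: "pi/2 \<le> 1 + a" if "2/pi \<le> a"
    using lower_opt(1)[OF large_pos large] that by simp
  show ?thesis
  proof (intro conjI impI)
    assume "0 \<le> a \<and> a \<le> 1/2"
    then have a: "0 \<le> a" "a \<le> 1/2" by auto
    show "\<forall>x>0. (1 + a) * x / (a + sqrt (1 + x\<^sup>2)) < arctan x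
        \<and> arctan x < (pi/2) * x / (a + sqrt (1 + x\<^sup>2))"
      using small[OF a] upper[OF a(1) order_refl small_le[OF a]] by blast
    show "\<forall>c > 1 + a. \<not> (\<forall>x>0. c * x / (a + sqrt (1 + x\<^sup>2)) < arctan x)"
      using lower_opt(1)[OF a(1)] by (meson not_le)
    show "\<forall>c < pi/2. \<not> (\<forall>x>0. arctan x < c * x / (a + sqrt (1 + x\<^sup>2)))"
      using upper_opt(2)[OF a(1)] by (meson not_le)
  next
    assume "1/2 < a \<and> a < 2/pi"
    then have a: "0 < a" "0 \<le> a" by auto
    show "\<forall>x>0. 4 * a * (1 - a\<^sup>2) * x / (a + sqrt (1 + x\<^sup>2)) < arctan x
        \<and> arctan x < max (pi/2) (1 + a) * x / (a + sqrt (1 + x\<^sup>2))"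
      using square[OF a(1)] upper[OF a(2) max.cobounded1 max.cobounded2] by blast
    show "\<forall>c < max (pi/2) (1 + a). \<not> (\<forall>x>0. arctan x < c * x / (a + sqrt (1 + x\<^sup>2)))"
      using upper_opt[OF a(2)] by (meson max.boundedI not_le)
  next
    assume a: "2/pi \<le> a"
    show "\<forall>x>0. (pi/2) * x / (a + sqrt (1 + x\<^sup>2)) < arctan x
        \<and> arctan x < (1 + a) * x / (a + sqrt (1 + x\<^sup>2))"
      using large[OF a] upper[OF large_pos[OF a] large_ge[OF a] order_refl] by blast
    show "\<forall>c > pi/2. \<not> (\<forall>x>0. c * x / (a + sqrt (1 + x\<^sup>2)) < arctan x)"
      using lower_opt(2)[OF large_pos[OF a]] by (meson not_le)
    show "\<forall>c < 1 + a. \<not> (\<forall>x>0. arctan x < c * x / (a + sqrt (1 + x\<^sup>2)))"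
      using upper_opt(1)[OF large_pos[OF a]] by (meson not_le)
  qed
qed

end
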